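(* Let $\{\{X_s:s\in\omega^{n+1}\}:n\in\omega\}$ be a family such that for every $n\in\omega$, $\{X_s:s\in\omega^{n+1}\}$ is a partition of $\omega$ into infinite sets, and such that $\bigcap_{i\in F}X_{s_i}$ is infinite for every finite $F\subseteq\omega$ and every choice of $s_i\in\omega^{i+1}$, $i\in F$. Let $\mathrm{Fin}'_\omega$ be the ideal on $\omega$ defined from this family as in the context. Then $\mathrm{Fin}_\omega\not\sqsubseteq\mathrm{Fin}'_\omega$, i.e., there is no bijection $f:\omega\to\sum_{i>0}\omega^i$ such that $f^{-1}[A]\in\mathrm{Fin}'_\omega$ for every $A\in\mathrm{Fin}_\omega$.
   Context: An ideal on a countably infinite set $X$ is a family of subsets of $X$ closed under subsets and finite unions, not containing $X$ and containing all finite subsets of $X$; for an ideal $\mathcal{I}$ on $X$, $\mathcal{I}^\star=\{X\setminus A:A\in\mathcal{I}\}$. $\mathrm{Fin}$ is the ideal of finite subsets of $\omega$. For $n\ge1$ the ideal $\mathrm{Fin}^n$ on $\omega^n$ is defined by $\mathrm{Fin}^1=\mathrm{Fin}$ and: $A\subseteq\omega^{n+1}$ is in $\mathrm{Fin}^{n+1}$ iff $\{i\in\omega:\{x\in\omega^n:(i,x)\in A\}\notin\mathrm{Fin}^n\}$ is finite. For $n\in\omega$, $\mathrm{Fin}^{n+2}(\{X_s:s\in\omega^{n+1}\})$ is the family of all $A\subseteq\omega$ with $\{s\in\omega^{n+1}:A\cap X_s\text{ infinite}\}\in\mathrm{Fin}^{n+1}$; $\mathrm{Fin}'_\omega$ is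 the ideal on $\omega$ generated by $\bigcup_{n\in\omega}\mathrm{Fin}^{n+2}(\{X_s:s\in\omega^{n+1}\})$ (sets contained in finite unions of members). $\mathrm{Fin}_\omega$ is the ideal on $\sum_{n\ge1}\omega^n=\{(n,x):n\ge1,x\in\omega^n\}$ defined as follows: for $1\le i\le j$ let $\pi_{i,j}:\omega^j\to\omega^i$, $\pi_{i,j}(x_0,\dots,x_{j-1})=(x_{j-i},\dots,x_{j-1})$; then $M\in\mathrm{Fin}_\omega$ iff there are $i\ge1$ and $P\subseteq\omega^i$ with $\omega^i\setminus P\in\mathrm{Fin}^i$ such that $M\cap\{(j,x):j\ge i,\ x\in\omega^j,\ \pi_{i,j}(x)\in P\}=\emptyset$. For ideals $\mathcal{I},\mathcal{J}$, $\mathcal{I}\sqsubseteq\mathcal{J}$ means there is a bijection $f:\mathrm{dom}(\mathcal{J})\to\mathrm{dom}(\mathcal{I})$ with $f^{-1}[A]\in\mathcal{J}$ for all $A\in\mathcal{I}$. *)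

theory Defs
  imports "HOL-Library.Disjoint_Sets"
begin

text \<open>
  Points of \<open>\<omega>\<^sup>n\<close> are the lists of naturals of length \<open>n\<close>;
  \<open>(i, x) \<in> \<omega> \<times> \<omega>\<^sup>n = \<omega>\<^sup>n\<^sup>+\<^sup>1\<close> is \<open>i # x\<close>, and \<open>\<omega>\<close> is identified with \<open>\<omega>\<^sup>1\<close>
  via \<open>i \<mapsto> [i]\<close>.
\<close>

definition omega_pow :: "nat \<Rightarrow> nat list set" where
  "omega_pow n = {x. length x = n}"

text \<open>The value at \<open>0\<close> is a dummy: \<open>Fin\<^sup>n\<close> is only considered for \<open>n \<ge> 1\<close>.\<close>

fun Fin_pow :: "nat \<Rightarrow> nat list set set" where
  "Fin_pow 0 = {{}}"
| "Fin_pow (Suc 0) = {A. A \<subseteq> omega_pow 1 \<and> finite A}"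
| "Fin_pow (Suc (Suc n)) =
    {A. A \<subseteq> omega_pow (Suc (Suc n)) \<and>
        finite {i. {x \<in> omega_pow (Suc n). i # x \<in> A} \<notin> Fin_pow (Suc n)}}"

text \<open>\<open>Fin_part n X\<close> is \<open>Fin\<^sup>n\<^sup>+\<^sup>2({X\<^sub>s : s \<in> \<omega>\<^sup>n\<^sup>+\<^sup>1})\<close>.\<close>

definition Fin_part :: "nat \<Rightarrow> (nat list \<Rightarrow> nat set) \<Rightarrow> nat set set" where
  "Fin_part n X = {A. {s \<in> omega_pow (n + 1). infinite (A \<inter> X s)} \<in> Fin_pow (n + 1)}"

definition generated_ideal :: "'a set set \<Rightarrow> 'a set set" where
  "generated_ideal \<G> = {A. \<exists>\<F>. finite \<F> \<and> \<F> \<subseteq> \<G> \<and> A \<subseteq> \<Union>\<F>}"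

definition Fin'_omega :: "(nat list \<Rightarrow> nat set) \<Rightarrow> nat set set" where
  "Fin'_omega X = generated_ideal (\<Union>n. Fin_part n X)"

definition omega_sum :: "(nat \<times> nat list) set" where
  "omega_sum = (SIGMA n:{1..}. omega_pow n)"

text \<open>\<open>last_proj i j\<close> is \<open>\<pi>\<^sub>i\<^sub>,\<^sub>j\<close>, which keeps the last \<open>i\<close> coordinates.\<close>

definition last_proj :: "nat \<Rightarrow> nat \<Rightarrow> nat list \<Rightarrow> nat list" where
  "last_proj i j x = drop (j - i) x"

definition Fin_omega :: "(nat \<times> nat list) set set" where
  "Fin_omega = {M. M \<subseteq> omega_sum \<and>
     (\<exists>i\<ge>1. \<exists>P\<subseteq>omega_pow i. omega_pow i - P \<in> Fin_pow i \<and>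
        M \<inter> {(j, x). j \<ge> i \<and> x \<in> omega_pow j \<and> last_proj i j x \<in> P} = {})}"

text \<open>\<open>ideal_sqsub S \<I> T \<J>\<close> is \<open>\<I> \<sqsubseteq> \<J>\<close> for \<open>\<I>\<close> an ideal on \<open>S\<close> and \<open>\<J>\<close> an ideal on \<open>T\<close>.\<close>

definition ideal_sqsub :: "'a set \<Rightarrow> 'a set set \<Rightarrow> 'b set \<Rightarrow> 'b set set \<Rightarrow> bool" where
  "ideal_sqsub S \<I> T \<J> \<longleftrightarrow> (\<exists>f. bij_betw f T S \<and> (\<forall>A\<in>\<I>. f -` A \<inter> T \<in> \<J>))"

end

(*
  Let f map omega to the sum of the powers of omega and pull Fin_omega back into Fin'_omega. Write
  x_0, x_1, ... for the coordinates of f(x) counted from the end. Fin'_omega is the increasing union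
  of the ideals I_m generated by the first m + 1 partitions. The sets {x_0 < g(x_1)} are pullbacks of
  members of Fin_omega, and a diagonal choice of g shows that, on some {x_1 >= m}, they all lie in
  the same I_m. For sigma in omega^(m+1) let Y_sigma be the intersection of the cells X_s over the
  nonempty prefixes s of sigma. A member of I_m has finite intersection with Y_sigma for
  Fin^(m+1)-almost all sigma, so x_1 takes only finitely many values on almost every Y_sigma.
  By independence Y_sigma is positive for the ideal K generated by the remaining partitions, so it
  has a K-positive part W_sigma on which x_1 is constant. The coordinates x_(m+2), ..., x_1 of the
  sets W_sigma then behave like a map from omega^(m+1) to omega^(m+2), and as Fin^(m+2) is not
  Katetov below Fin^(m+1), some member of Fin_omega has a pullback that is K-positive on a
  Fin^(m+1)-positive set of fibres. Such a pullback is not in Fin'_omega.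
*)
theory Submission
  imports Defs "HOL-Library.Countable"
begin

section \<open>Ideals generated by a family\<close>

lemma generated_ideal_subset: "A \<in> generated_ideal G \<Longrightarrow> B \<subseteq> A \<Longrightarrow> B \<in> generated_ideal G"
  unfolding generated_ideal_def by blast

lemma generated_ideal_superset: "A \<in> G \<Longrightarrow> A \<in> generated_ideal G"
  unfolding generated_ideal_def by (auto intro!: exI[of _ "{A}"])

lemma generated_ideal_empty: "{} \<in> generated_ideal G"
  unfolding generated_ideal_def by (auto intro!: exI[of _ "{}"])

lemma generated_ideal_Un:
  assumes "A \<in> generated_ideal G" "B \<in> generated_ideal G"
  shows "A \<union> B \<in> generated_ideal G"
proof -
  obtain F where "finite F" "F \<subseteq> G" "A \<subseteq> \<Union>F"
    using assms(1) unfolding generated_ideal_def by blast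
  moreover obtain F' where "finite F'" "F' \<subseteq> G" "B \<subseteq> \<Union>F'"
    using assms(2) unfolding generated_ideal_def by blast
  ultimately show ?thesis
    unfolding generated_ideal_def by (auto intro!: exI[of _ "F \<union> F'"])
qed

lemma generated_ideal_UN:
  assumes "finite I" "\<And>i. i \<in> I \<Longrightarrow> A i \<in> generated_ideal G"
  shows "(\<Union>i\<in>I. A i) \<in> generated_ideal G"
  using assms by (induction I) (auto intro: generated_ideal_empty generated_ideal_Un)

lemma generated_ideal_Un_split:
  assumes "A \<in> generated_ideal (G \<union> H)"
  obtains B C where "B \<in> generated_ideal G" "C \<in> generated_ideal H" "A \<subseteq> B \<union> C"
proof -
  obtain F where F: "finite F" "F \<subseteq> G \<union> H" "A \<subseteq> \<Union>F"
    using assms unfolding generated_ideal_def by blast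
  have "\<Union>(F \<inter> G) \<in> generated_ideal G"
    unfolding generated_ideal_def using F(1) by (auto intro!: exI[of _ "F \<inter> G"])
  moreover have "\<Union>(F \<inter> H) \<in> generated_ideal H"
    unfolding generated_ideal_def using F(1) by (auto intro!: exI[of _ "F \<inter> H"])
  moreover have "A \<subseteq> \<Union>(F \<inter> G) \<union> \<Union>(F \<inter> H)"
    using F by blast
  ultimately show ?thesis using that by blast
qed

section \<open>The ideals Fin^n\<close>

lemma Fin_pow_subset_omega_pow: "A \<in> Fin_pow n \<Longrightarrow> A \<subseteq> omega_pow n"
  by (cases n rule: Fin_pow.cases) auto

lemma omega_pow_0: "omega_pow 0 = {[]}"
  by (auto simp: omega_pow_def)

lemma Cons_in_omega_pow: "i # x \<in> omega_pow (Suc n) \<longleftrightarrow> x \<in> omega_pow n"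
  by (auto simp: omega_pow_def)

text \<open>With the dummy value at \<open>0\<close>, the recursion is uniform.\<close>

lemma Fin_pow_Suc_iff:
  "A \<in> Fin_pow (Suc n) \<longleftrightarrow>
     A \<subseteq> omega_pow (Suc n) \<and> finite {i. {x \<in> omega_pow n. i # x \<in> A} \<notin> Fin_pow n}"
proof (cases n)
  case 0
  have "finite A \<longleftrightarrow> finite {i. [i] \<in> A}" if "A \<subseteq> omega_pow 1"
  proof -
    have "A = (\<lambda>i. [i]) ` {i. [i] \<in> A}"
      using that by (auto simp: omega_pow_def length_Suc_conv)
    then show ?thesis
      by (metis (no_types, lifting) finite_imageD finite_imageI inj_onI list.inject)
  qed
  then show ?thesis using 0 by (auto simp: omega_pow_0)
qed auto

declare Fin_pow.simps(2,3) [simp del]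

lemma Fin_pow_empty: "{} \<in> Fin_pow n"
  by (induction n) (auto simp: Fin_pow_Suc_iff)

lemma Fin_pow_subset: "A \<in> Fin_pow n \<Longrightarrow> B \<subseteq> A \<Longrightarrow> B \<in> Fin_pow n"
proof (induction n arbitrary: A B)
  case (Suc n)
  have "{i. {x \<in> omega_pow n. i # x \<in> B} \<notin> Fin_pow n}
        \<subseteq> {i. {x \<in> omega_pow n. i # x \<in> A} \<notin> Fin_pow n}"
    using Suc.IH Suc.prems(2) by (smt (verit, best) Collect_mono subset_iff)
  with Suc.prems show ?case
    by (auto simp: Fin_pow_Suc_iff intro: finite_subset)
qed auto

lemma Fin_pow_Un: "A \<in> Fin_pow n \<Longrightarrow> B \<in> Fin_pow n \<Longrightarrow> A \<union> B \<in> Fin_pow n"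
proof (induction n arbitrary: A B)
  case (Suc n)
  have eq: "{x \<in> omega_pow n. i # x \<in> A \<union> B}
        = {x \<in> omega_pow n. i # x \<in> A} \<union> {x \<in> omega_pow n. i # x \<in> B}" for i
    by auto
  have "{i. {x \<in> omega_pow n. i # x \<in> A \<union> B} \<notin> Fin_pow n}
        \<subseteq> {i. {x \<in> omega_pow n. i # x \<in> A} \<notin> Fin_pow n}
          \<union> {i. {x \<in> omega_pow n. i # x \<in> B} \<notin> Fin_pow n}"
    using Suc.IH unfolding eq by blast
  with Suc.prems show ?case
    by (auto simp: Fin_pow_Suc_iff intro: finite_subset)
qed auto

lemma Fin_pow_UN:
  assumes "finite I" "\<And>i. i \<in> I \<Longrightarrow> A i \<in> Fin_pow n"
  shows "(\<Union>i\<in>I. A i) \<in> Fin_pow n"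
  using assms by (induction I) (auto intro: Fin_pow_empty Fin_pow_Un)

lemma omega_pow_notin_Fin_pow: "omega_pow n \<notin> Fin_pow n"
proof (induction n)
  case (Suc n)
  then show ?case
    by (auto simp: Fin_pow_Suc_iff Cons_in_omega_pow)
qed (auto simp: omega_pow_0)

text \<open>Free coordinates appended at the end only turn each section into a shorter cylinder, so
  induction on the leading coordinates applies. This later carries smallness from an early partition
  up to sequences of length \<open>Suc m\<close>.\<close>

lemma Fin_pow_take:
  assumes "A \<in> Fin_pow n"
  shows "{u \<in> omega_pow (n + k). take n u \<in> A} \<in> Fin_pow (n + k)"
  using assms
proof (induction n arbitrary: A)
  case 0
  then show ?case by (auto intro: Fin_pow_empty)
next
  case (Suc n)
  let ?B = "{u \<in> omega_pow (Suc n + k). take (Suc n) u \<in> A}"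
  have "{x \<in> omega_pow (n + k). i # x \<in> ?B} \<in> Fin_pow (n + k)"
    if "{x \<in> omega_pow n. i # x \<in> A} \<in> Fin_pow n" for i
  proof (rule Fin_pow_subset[OF Suc.IH[OF that]])
    show "{x \<in> omega_pow (n + k). i # x \<in> ?B}
          \<subseteq> {u \<in> omega_pow (n + k). take n u \<in> {x \<in> omega_pow n. i # x \<in> A}}"
      by (auto simp: omega_pow_def)
  qed
  then have "{i. {x \<in> omega_pow (n + k). i # x \<in> ?B} \<notin> Fin_pow (n + k)}
             \<subseteq> {i. {x \<in> omega_pow n. i # x \<in> A} \<notin> Fin_pow n}"
    by blast
  with Suc.prems have "?B \<in> Fin_pow (Suc (n + k))"
    unfolding Fin_pow_Suc_iff by (auto intro: finite_subset)
  then show ?case by simp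
qed

lemma Fin_pow_2_graph: "{[b, a] | a b. a < g b} \<in> Fin_pow 2"
proof -
  have "{x \<in> omega_pow 1. b # x \<in> {[b, a] | a b. a < g b}} = (\<lambda>a. [a]) ` {..<g b}" for b
    by (auto simp: omega_pow_def)
  then show ?thesis
    by (auto simp: numeral_2_eq_2 Fin_pow.simps(2,3)) (auto simp: omega_pow_def)
qed

lemma Fin_pow_2_columns:
  assumes "finite B"
  shows "{[b, a] | a b. b \<in> B} \<in> Fin_pow 2"
proof -
  have "{x \<in> omega_pow 1. i # x \<in> {[b, a] | a b. b \<in> B}} \<in> Fin_pow 1" if "i \<notin> B" for i
    using that Fin_pow_empty[of 1] by simp
  then have "{i. {x \<in> omega_pow 1. i # x \<in> {[b, a] | a b. b \<in> B}} \<notin> Fin_pow 1} \<subseteq> B"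
    by blast
  then show ?thesis
    using finite_subset[OF _ assms] by (auto simp: numeral_2_eq_2 Fin_pow.simps(2,3)) (auto simp: omega_pow_def)
qed

section \<open>Coordinates counted from the end, and pullbacks from \<open>Fin_omega\<close>\<close>

abbreviation last_coords :: "nat \<Rightarrow> nat list \<Rightarrow> nat list" where
  "last_coords i u \<equiv> last_proj i (length u) u"

abbreviation coord_from_end :: "nat \<Rightarrow> nat list \<Rightarrow> nat" where
  "coord_from_end i u \<equiv> u ! (length u - Suc i)"

lemma last_coords_Suc:
  "i < length u \<Longrightarrow> last_coords (Suc i) u = coord_from_end i u # last_coords i u"
  unfolding last_proj_def
  by (metis Cons_nth_drop_Suc Suc_diff_Suc diff_less less_nat_zero_code not_gr_zero
      zero_less_Suc length_0_conv length_greater_0_conv)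

lemma last_coords_2:
  "2 \<le> length u \<Longrightarrow> last_coords 2 u = [coord_from_end 1 u, coord_from_end 0 u]"
  using last_coords_Suc[of 0 u] last_coords_Suc[of 1 u]
  by (cases "u = []") (auto simp: numeral_2_eq_2 last_proj_def)

text \<open>Membership in \<open>Fin_omega\<close> witnessed at index \<open>i\<close> says nothing
  about sequences shorter than \<open>i\<close>, so all of these can be added to the pullback of
  \<open>Q\<close>. The witness is the complement of \<open>Q\<close>.\<close>

lemma vimage_last_coords_in_ideal:
  assumes f: "range f \<subseteq> omega_sum" and ideal: "\<And>A. A \<in> Fin_omega \<Longrightarrow> f -` A \<in> \<J>"
    and "1 \<le> i" "Q \<in> Fin_pow i"
  shows "{x. length (snd (f x)) < i \<or> last_coords i (snd (f x)) \<in> Q} \<in> \<J>"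
proof -
  let ?M = "{(j, u) \<in> omega_sum. j < i \<or> last_proj i j u \<in> Q}"
  have Q: "Q \<subseteq> omega_pow i" by (rule Fin_pow_subset_omega_pow) fact
  have "?M \<in> Fin_omega"
    unfolding Fin_omega_def using assms(3,4) Q
    by (auto intro!: exI[of _ i] exI[of _ "omega_pow i - Q"] simp: double_diff)
  then have "f -` ?M \<in> \<J>" by (rule ideal)
  moreover have "f -` ?M = {x. length (snd (f x)) < i \<or> last_coords i (snd (f x)) \<in> Q}"
  proof -
    have "f x \<in> omega_sum \<and> fst (f x) = length (snd (f x))" for x
    proof -
      have "f x \<in> omega_sum" using f by blast
      then show ?thesis by (auto simp: omega_sum_def omega_pow_def)
    qed
    then show ?thesis by (auto simp: case_prod_beta) (metis prod.collapse)+
  qed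
  ultimately show ?thesis by simp
qed

section \<open>A rank obstruction between powers of Fin\<close>

text \<open>
  The argument that \<open>Fin\<^sup>n\<^sup>+\<^sup>1\<close> is not Katetov below \<open>Fin\<^sup>n\<close>, with the points \<open>\<sigma>\<close> replaced by
  \<open>K\<close>-positive fibres \<open>W \<sigma>\<close>. Constancy of the second coordinate from the end on each fibre is
  what makes the case \<open>n = 0\<close> true: a single column is in \<open>Fin\<^sup>2\<close>.
\<close>

lemma Fin_pow_rank_obstruction:
  fixes l :: "'a \<Rightarrow> nat list" and W :: "nat list \<Rightarrow> 'a set" and G :: "'a set set"
  defines "K \<equiv> generated_ideal G"
  assumes "S \<subseteq> omega_pow n" "S \<notin> Fin_pow n"
    and "\<And>\<sigma>. \<sigma> \<in> S \<Longrightarrow> W \<sigma> \<notin> K"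
    and "\<And>\<sigma> x. \<sigma> \<in> S \<Longrightarrow> x \<in> W \<sigma> \<Longrightarrow> n + 2 \<le> length (l x) \<and> coord_from_end 1 (l x) = b \<sigma>"
  shows "\<exists>Q\<in>Fin_pow (n + 2). {\<sigma> \<in> S. W \<sigma> \<inter> {x. last_coords (n + 2) (l x) \<in> Q} \<notin> K} \<notin> Fin_pow n"
  using assms(2-)
proof (induction n arbitrary: S W b)
  case 0
  then have S: "S = {[]}" by (auto simp: omega_pow_0)
  let ?Q = "{[c, a] | a c. c \<in> {b []}}"
  have "last_coords 2 (l x) \<in> ?Q" if "x \<in> W []" for x
    using 0(4)[of "[]" x] S that by (simp add: last_coords_2)
  then have "W [] \<inter> {x. last_coords (0 + 2) (l x) \<in> ?Q} = W []"
    unfolding add_0_left by blast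
  then have "{\<sigma> \<in> S. W \<sigma> \<inter> {x. last_coords (0 + 2) (l x) \<in> ?Q} \<notin> K} = S"
    using 0(3)[of "[]"] S by auto
  then have "{\<sigma> \<in> S. W \<sigma> \<inter> {x. last_coords (0 + 2) (l x) \<in> ?Q} \<notin> K} \<notin> Fin_pow 0"
    using 0(2) by simp
  moreover have "?Q \<in> Fin_pow (0 + 2)"
    using Fin_pow_2_columns[of "{b []}"] unfolding add_0_left by blast
  ultimately show ?case by blast
next
  case (Suc n)
  note K_subset = generated_ideal_subset[of _ G, folded K_def]
  define Sec where "Sec t = {\<sigma> \<in> omega_pow n. t # \<sigma> \<in> S}" for t
  define T where "T = {t. Sec t \<notin> Fin_pow n}"
  have "infinite T"
    using Suc.prems(1,2) unfolding Fin_pow_Suc_iff T_def Sec_def by blast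
  have "\<exists>Q\<in>Fin_pow (n + 2).
      {\<sigma> \<in> Sec t. W (t # \<sigma>) \<inter> {x. last_coords (n + 2) (l x) \<in> Q} \<notin> K} \<notin> Fin_pow n"
    if "t \<in> T" for t
  proof (rule Suc.IH)
    show "Sec t \<subseteq> omega_pow n" "Sec t \<notin> Fin_pow n"
      using that by (auto simp: Sec_def T_def)
    show "W (t # \<sigma>) \<notin> K" if "\<sigma> \<in> Sec t" for \<sigma>
      using that Suc.prems(3) by (auto simp: Sec_def)
    show "n + 2 \<le> length (l x) \<and> coord_from_end 1 (l x) = b (t # \<sigma>)"
      if "\<sigma> \<in> Sec t" "x \<in> W (t # \<sigma>)" for \<sigma> x
      using that Suc.prems(4)[of "t # \<sigma>" x] by (auto simp: Sec_def)
  qed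
  then have "\<forall>t\<in>T. \<exists>Q. Q \<in> Fin_pow (n + 2) \<and>
      {\<sigma> \<in> Sec t. W (t # \<sigma>) \<inter> {x. last_coords (n + 2) (l x) \<in> Q} \<notin> K} \<notin> Fin_pow n"
    by blast
  from bchoice[OF this] obtain Q where Q: "\<And>t. t \<in> T \<Longrightarrow> Q t \<in> Fin_pow (n + 2)"
    and Qpos: "\<And>t. t \<in> T \<Longrightarrow>
      {\<sigma> \<in> Sec t. W (t # \<sigma>) \<inter> {x. last_coords (n + 2) (l x) \<in> Q t} \<notin> K} \<notin> Fin_pow n"
    by blast
  \<comment> \<open>The induction hypothesis handles the last \<open>n + 2\<close> coordinates over
    each \<open>t\<close>; what remains is to control \<open>p\<close>, the coordinate just before
    them.\<close>
  define W' where "W' t \<sigma> = W (t # \<sigma>) \<inter> {x. last_coords (n + 2) (l x) \<in> Q t}" for t \<sigma>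
  define p where "p x = coord_from_end (n + 2) (l x)" for x
  have split: "last_coords (n + 3) (l x) = p x # last_coords (n + 2) (l x)"
    if "\<sigma> \<in> Sec t" "x \<in> W (t # \<sigma>)" for t \<sigma> x
    using Suc.prems(4)[of "t # \<sigma>" x] that last_coords_Suc[of "n + 2" "l x"]
    by (auto simp: Sec_def p_def numeral_3_eq_3)
  define pos where "pos t R \<longleftrightarrow> {\<sigma> \<in> Sec t. W' t \<sigma> \<inter> {x. p x \<in> R} \<notin> K} \<notin> Fin_pow n"
    for t and R :: "nat set"
  \<comment> \<open>It suffices to choose, for infinitely many \<open>t\<close>, a set
    \<open>R t\<close> that \<open>p\<close> hits positively, such that all \<open>c # y\<close>
    with \<open>c\<close> in \<open>R t\<close> and \<open>y\<close> in \<open>Q t\<close> fit into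
    one small set.\<close>
  have finish: "\<exists>Q\<in>Fin_pow (Suc n + 2).
      {\<sigma> \<in> S. W \<sigma> \<inter> {x. last_coords (Suc n + 2) (l x) \<in> Q} \<notin> K} \<notin> Fin_pow (Suc n)"
    if q: "q \<in> Fin_pow (n + 3)" and T': "infinite T'" "T' \<subseteq> T" "\<And>t. t \<in> T' \<Longrightarrow> pos t (R t)"
      and sub: "\<And>t c y. t \<in> T' \<Longrightarrow> c \<in> R t \<Longrightarrow> y \<in> Q t \<Longrightarrow> c # y \<in> q" for q T' R
  proof (rule bexI[of _ q])
    show "q \<in> Fin_pow (Suc n + 2)" using q by (simp add: numeral_3_eq_3)
    let ?D = "{\<sigma> \<in> S. W \<sigma> \<inter> {x. last_coords (Suc n + 2) (l x) \<in> q} \<notin> K}"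
    have "{\<sigma> \<in> omega_pow n. t # \<sigma> \<in> ?D} \<notin> Fin_pow n" if t: "t \<in> T'" for t
    proof
      assume "{\<sigma> \<in> omega_pow n. t # \<sigma> \<in> ?D} \<in> Fin_pow n"
      moreover have "{\<sigma> \<in> Sec t. W' t \<sigma> \<inter> {x. p x \<in> R t} \<notin> K} \<subseteq> {\<sigma> \<in> omega_pow n. t # \<sigma> \<in> ?D}"
      proof safe
        fix \<sigma> assume \<sigma>: "\<sigma> \<in> Sec t" and K: "W' t \<sigma> \<inter> {x. p x \<in> R t} \<notin> K"
        show "\<sigma> \<in> omega_pow n" "t # \<sigma> \<in> S" using \<sigma> by (auto simp: Sec_def)
        assume "W (t # \<sigma>) \<inter> {x. last_coords (Suc n + 2) (l x) \<in> q} \<in> K"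
        moreover have "W' t \<sigma> \<inter> {x. p x \<in> R t}
            \<subseteq> W (t # \<sigma>) \<inter> {x. last_coords (Suc n + 2) (l x) \<in> q}"
          using split[OF \<sigma>] sub[OF t] by (auto simp: W'_def numeral_3_eq_3)
        ultimately show False using K K_subset by blast
      qed
      ultimately show False using T'(3)[OF t] Fin_pow_subset unfolding pos_def by blast
    qed
    then have "T' \<subseteq> {t. {\<sigma> \<in> omega_pow n. t # \<sigma> \<in> ?D} \<notin> Fin_pow n}" by blast
    then show "?D \<notin> Fin_pow (Suc n)"
      using T'(1) finite_subset unfolding Fin_pow_Suc_iff by blast
  qed
  show ?case
  proof (cases "\<exists>c. infinite {t \<in> T. pos t {c}}")
    case True
    then obtain c where c: "infinite {t \<in> T. pos t {c}}" by blast
    \<comment> \<open>If one value \<open>c\<close> serves infinitely many \<open>t\<close>, the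
      whole section over \<open>c\<close> is a small set containing everything required.\<close>
    let ?q = "{c # y | y. y \<in> omega_pow (n + 2)}"
    have "{x \<in> omega_pow (n + 2). i # x \<in> ?q} \<in> Fin_pow (n + 2)" if "i \<noteq> c" for i
      using that Fin_pow_empty[of "n + 2"] by simp
    then have "{i. {x \<in> omega_pow (n + 2). i # x \<in> ?q} \<notin> Fin_pow (n + 2)} \<subseteq> {c}"
      by blast
    then have "?q \<in> Fin_pow (Suc (n + 2))"
      unfolding Fin_pow_Suc_iff by (auto simp: Cons_in_omega_pow intro: finite_subset)
    then show ?thesis
      using c Q[THEN Fin_pow_subset_omega_pow]
      by (intro finish[where T' = "{t \<in> T. pos t {c}}" and R = "\<lambda>_. {c}"])
         (auto simp: numeral_3_eq_3)
  next
    case False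
    \<comment> \<open>If no single value is positive over \<open>t\<close>, removing the finitely
      many values below \<open>t\<close> loses only a small set of fibres, so the tail
      \<open>{t..}\<close> is positive.\<close>
    have "\<exists>R. pos t R \<and> ((\<exists>c. R = {c} \<and> pos t {c}) \<or> R = {t..})" if t: "t \<in> T" for t
    proof (cases "\<exists>c. pos t {c}")
      case False
      let ?S = "\<lambda>R. {\<sigma> \<in> Sec t. W' t \<sigma> \<inter> {x. p x \<in> R} \<notin> K}"
      have small: "(\<Union>c<t. ?S {c}) \<in> Fin_pow n"
        using False by (intro Fin_pow_UN) (auto simp: pos_def)
      have "{\<sigma> \<in> Sec t. W' t \<sigma> \<notin> K} \<subseteq> (\<Union>c<t. ?S {c}) \<union> ?S {t..}"
      proof (rule ccontr)
        assume "\<not> ?thesis"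
        then obtain \<sigma> where \<sigma>: "\<sigma> \<in> Sec t" "W' t \<sigma> \<notin> K" "W' t \<sigma> \<inter> {x. p x \<in> {t..}} \<in> K"
          "\<And>c. c < t \<Longrightarrow> W' t \<sigma> \<inter> {x. p x \<in> {c}} \<in> K" by auto
        have "(\<Union>c<t. W' t \<sigma> \<inter> {x. p x \<in> {c}}) \<union> W' t \<sigma> \<inter> {x. p x \<in> {t..}} \<in> K"
          unfolding K_def
          by (intro generated_ideal_Un generated_ideal_UN) (use \<sigma> in \<open>auto simp: K_def\<close>)
        moreover have "W' t \<sigma> \<subseteq> (\<Union>c<t. W' t \<sigma> \<inter> {x. p x \<in> {c}}) \<union> W' t \<sigma> \<inter> {x. p x \<in> {t..}}"
          by force
        ultimately show False using \<sigma>(2) K_subset by blast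
      qed
      then have "?S {t..} \<notin> Fin_pow n"
        using Qpos[OF t, folded W'_def] Fin_pow_subset Fin_pow_Un[OF small] by blast
      then have "pos t {t..}" by (simp only: pos_def not_False_eq_True)
      then show ?thesis by blast
    qed auto
    then have "\<forall>t\<in>T. \<exists>R. pos t R \<and> ((\<exists>c. R = {c} \<and> pos t {c}) \<or> R = {t..})" by blast
    from bchoice[OF this] obtain R where R: "\<And>t. t \<in> T \<Longrightarrow> pos t (R t)"
      "\<And>t. t \<in> T \<Longrightarrow> (\<exists>c. R t = {c} \<and> pos t {c}) \<or> R t = {t..}"
      by blast
    let ?q = "{c # y | c y. \<exists>t\<in>T. c \<in> R t \<and> y \<in> Q t}"
    \<comment> \<open>A value \<open>c\<close> lies in a tail \<open>{t..}\<close> only for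
      \<open>t\<close> up to \<open>c\<close>, and is a positive singleton for finitely many
      \<open>t\<close> by the case assumption. So each section of \<open>?q\<close> is covered by
      finitely many of the \<open>Q t\<close>.\<close>
    have fin: "finite {t \<in> T. c \<in> R t}" for c
    proof (rule finite_subset)
      show "{t \<in> T. c \<in> R t} \<subseteq> {t \<in> T. pos t {c}} \<union> {..c}"
        using R(2) by force
      show "finite ({t \<in> T. pos t {c}} \<union> {..c})" using False by auto
    qed
    have "{x \<in> omega_pow (n + 2). c # x \<in> ?q} \<in> Fin_pow (n + 2)" for c
    proof (rule Fin_pow_subset)
      show "(\<Union>t\<in>{t \<in> T. c \<in> R t}. Q t) \<in> Fin_pow (n + 2)"
        using fin Q by (intro Fin_pow_UN) auto
    qed auto
    moreover have "?q \<subseteq> omega_pow (Suc (n + 2))"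
      using Q[THEN Fin_pow_subset_omega_pow, THEN subsetD] by (auto simp: Cons_in_omega_pow)
    ultimately have "?q \<in> Fin_pow (Suc (n + 2))"
      unfolding Fin_pow_Suc_iff by auto
    then show ?thesis
      using \<open>infinite T\<close> R(1)
      by (intro finish[where T' = T and R = R])
         (auto simp: numeral_3_eq_3)
  qed
qed

section \<open>Fibres along the prefixes of a sequence\<close>

text \<open>
  Taking the indices \<open>s\<^sub>i\<close> to be the prefixes of a single \<open>\<sigma>\<close> costs nothing, since the independence
  hypothesis allows arbitrary choices, and turns smallness of \<open>s\<^sub>n\<close> in \<open>Fin\<^sup>n\<^sup>+\<^sup>1\<close> into smallness of
  \<open>\<sigma>\<close> in \<open>Fin\<^sup>m\<^sup>+\<^sup>1\<close>.
\<close>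

definition prefix_Inter :: "(nat list \<Rightarrow> nat set) \<Rightarrow> nat \<Rightarrow> nat list \<Rightarrow> nat set" where
  "prefix_Inter X m \<sigma> = (\<Inter>i\<le>m. X (take (Suc i) \<sigma>))"

lemma finite_in_Fin_part: "finite A \<Longrightarrow> A \<in> Fin_part n X"
  by (simp add: Fin_part_def Fin_pow_empty)

text \<open>A generator of level \<open>n\<close> meeting the fibre of \<sigma> in an infinite set
  also meets the larger cell of the prefix of length \<open>Suc n\<close>. Such prefixes form a
  small set, hence so does the cylinder over it.\<close>

lemma low_ideal_infinite_fibres:
  assumes "A \<in> generated_ideal (\<Union>n\<le>m. Fin_part n X)"
  shows "{\<sigma> \<in> omega_pow (Suc m). infinite (A \<inter> prefix_Inter X m \<sigma>)} \<in> Fin_pow (Suc m)"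
proof -
  obtain F where F: "finite F" "F \<subseteq> (\<Union>n\<le>m. Fin_part n X)" "A \<subseteq> \<Union>F"
    using assms unfolding generated_ideal_def by blast
  have "{\<sigma> \<in> omega_pow (Suc m). infinite (B \<inter> prefix_Inter X m \<sigma>)} \<in> Fin_pow (Suc m)"
    if "B \<in> F" for B
  proof -
    obtain n where n: "n \<le> m" "B \<in> Fin_part n X" using F(2) \<open>B \<in> F\<close> by blast
    let ?S = "{s \<in> omega_pow (Suc n). infinite (B \<inter> X s)}"
    have "?S \<in> Fin_pow (Suc n)" using n(2) by (simp add: Fin_part_def)
    then have small: "{\<sigma> \<in> omega_pow (Suc m). take (Suc n) \<sigma> \<in> ?S} \<in> Fin_pow (Suc m)"
      using Fin_pow_take[of ?S "Suc n" "m - n"] n(1) by simp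
    have "take (Suc n) \<sigma> \<in> ?S"
      if "\<sigma> \<in> omega_pow (Suc m)" "infinite (B \<inter> prefix_Inter X m \<sigma>)" for \<sigma>
    proof -
      have "B \<inter> prefix_Inter X m \<sigma> \<subseteq> B \<inter> X (take (Suc n) \<sigma>)"
        using n(1) by (auto simp: prefix_Inter_def)
      then have "infinite (B \<inter> X (take (Suc n) \<sigma>))" using that(2) finite_subset by blast
      then show ?thesis using that(1) n(1) by (simp add: omega_pow_def)
    qed
    then show ?thesis by (intro Fin_pow_subset[OF small]) blast
  qed
  then have "(\<Union>B\<in>F. {\<sigma> \<in> omega_pow (Suc m). infinite (B \<inter> prefix_Inter X m \<sigma>)}) \<in> Fin_pow (Suc m)"
    using F(1) by (intro Fin_pow_UN)
  moreover have "\<exists>B\<in>F. infinite (B \<inter> Y)" if "infinite (A \<inter> Y)" for Y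
  proof (rule ccontr)
    assume "\<not> ?thesis"
    then have "finite (\<Union>B\<in>F. B \<inter> Y)" using F(1) by (intro finite_UN_I) auto
    moreover have "A \<inter> Y \<subseteq> (\<Union>B\<in>F. B \<inter> Y)" using F(3) by auto
    ultimately show False using that finite_subset by blast
  qed
  ultimately show ?thesis by (elim Fin_pow_subset) auto
qed

text \<open>Split the set into a part from levels up to \<open>m\<close> and a part from higher
  levels. The first is finite on almost all fibres, and finite sets belong to the high ideal. The
  main proof contradicts this necessary condition.\<close>

lemma Fin'_omega_positive_fibres:
  assumes "A \<in> Fin'_omega X"
  shows "{\<sigma> \<in> omega_pow (Suc m). A \<inter> prefix_Inter X m \<sigma> \<notin> generated_ideal (\<Union>n\<in>{m<..}. Fin_part n X)}
         \<in> Fin_pow (Suc m)"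
proof -
  let ?low = "\<Union>n\<le>m. Fin_part n X" and ?high = "\<Union>n\<in>{m<..}. Fin_part n X"
  have "(\<Union>n. Fin_part n X) = ?low \<union> ?high"
    using linorder_not_le by fastforce
  then obtain B C where B: "B \<in> generated_ideal ?low" and C: "C \<in> generated_ideal ?high"
    and A: "A \<subseteq> B \<union> C"
    using assms generated_ideal_Un_split unfolding Fin'_omega_def by metis
  have "A \<inter> Y \<in> generated_ideal ?high" if "finite (B \<inter> Y)" for Y
  proof -
    have "B \<inter> Y \<in> generated_ideal ?high"
      using finite_in_Fin_part[OF that, of "Suc m"] by (intro generated_ideal_superset) auto
    from generated_ideal_Un[OF this C] show ?thesis
      by (rule generated_ideal_subset) (use A in auto)
  qed
  then show ?thesis
    using low_ideal_infinite_fibres[OF B] by (elim Fin_pow_subset) auto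
qed

text \<open>Given a finite cover by high generators, choose at each level one cell almost disjoint
  from all generators of that level. Independence makes the fibre meet these cells in an infinite
  set, yet the cover makes it finite.\<close>

lemma prefix_Inter_notin_high_ideal:
  assumes indep: "\<And>F s. finite F \<Longrightarrow> (\<And>i. i \<in> F \<Longrightarrow> s i \<in> omega_pow (i + 1)) \<Longrightarrow>
            infinite (\<Inter>i\<in>F. X (s i))"
    and "\<sigma> \<in> omega_pow (Suc m)"
  shows "prefix_Inter X m \<sigma> \<notin> generated_ideal (\<Union>n\<in>{m<..}. Fin_part n X)"
proof
  assume "prefix_Inter X m \<sigma> \<in> generated_ideal (\<Union>n\<in>{m<..}. Fin_part n X)"
  then obtain F where F: "finite F" "F \<subseteq> (\<Union>n\<in>{m<..}. Fin_part n X)" "prefix_Inter X m \<sigma> \<subseteq> \<Union>F"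
    unfolding generated_ideal_def by blast
  then have "\<forall>A\<in>F. \<exists>n. m < n \<and> A \<in> Fin_part n X" by auto
  from bchoice[OF this] obtain N where N: "\<And>A. A \<in> F \<Longrightarrow> m < N A \<and> A \<in> Fin_part (N A) X"
    by blast
  have "\<exists>s\<in>omega_pow (Suc n). \<forall>A\<in>F. N A = n \<longrightarrow> finite (A \<inter> X s)" for n
  proof (rule ccontr)
    assume "\<not> ?thesis"
    then have "omega_pow (Suc n)
        \<subseteq> (\<Union>A\<in>{A \<in> F. N A = n}. {s \<in> omega_pow (Suc n). infinite (A \<inter> X s)})" by auto
    moreover have "(\<Union>A\<in>{A \<in> F. N A = n}. {s \<in> omega_pow (Suc n). infinite (A \<inter> X s)}) \<in> Fin_pow (Suc n)"
      using F(1) N by (intro Fin_pow_UN) (auto simp: Fin_part_def)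
    ultimately show False using omega_pow_notin_Fin_pow Fin_pow_subset by blast
  qed
  then obtain s where s: "\<And>n. s n \<in> omega_pow (Suc n)"
    "\<And>A. A \<in> F \<Longrightarrow> finite (A \<inter> X (s (N A)))" by metis
  \<comment> \<open>The two choices never compete, because every level \<open>N A\<close> exceeds
    \<open>m\<close>.\<close>
  define s' where "s' i = (if i \<le> m then take (Suc i) \<sigma> else s i)" for i
  have "infinite (\<Inter>i\<in>{..m} \<union> N ` F. X (s' i))"
    using F(1) assms(2) s(1) by (intro indep) (auto simp: s'_def omega_pow_def)
  moreover have "(\<Inter>i\<in>{..m} \<union> N ` F. X (s' i)) \<subseteq> (\<Union>A\<in>F. A \<inter> X (s (N A)))"
  proof
    fix x assume x: "x \<in> (\<Inter>i\<in>{..m} \<union> N ` F. X (s' i))"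
    then have "x \<in> X (s' i)" if "i \<le> m" for i using that by blast
    then have "x \<in> prefix_Inter X m \<sigma>" by (simp add: prefix_Inter_def s'_def)
    then obtain A where A: "A \<in> F" "x \<in> A" using F(3) by blast
    then have "x \<in> X (s' (N A))" using x by auto
    then show "x \<in> (\<Union>A\<in>F. A \<inter> X (s (N A)))" using A N[OF A(1)] by (auto simp: s'_def)
  qed
  moreover have "finite (\<Union>A\<in>F. A \<inter> X (s (N A)))" using F(1) s(2) by (rule finite_UN_I)
  ultimately show False using finite_subset by blast
qed

section \<open>Diagonal choices of bounding functions\<close>

lemma generated_ideal_uniform_level:
  fixes p q :: "'a \<Rightarrow> nat"
  assumes "\<And>g. {x. P x \<and> q x < g (p x)} \<in> generated_ideal (\<Union>n. H n)"
  obtains m where "\<And>g. {x. P x \<and> m \<le> p x \<and> q x < g (p x)} \<in> generated_ideal (\<Union>n\<le>m. H n)"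
proof (rule ccontr)
  assume "\<not> thesis"
  then have "\<forall>m. \<exists>g. {x. P x \<and> m \<le> p x \<and> q x < g (p x)} \<notin> generated_ideal (\<Union>n\<le>m. H n)"
    using that by blast
  from choice[OF this] obtain g
    where g: "\<And>m. {x. P x \<and> m \<le> p x \<and> q x < g m (p x)} \<notin> generated_ideal (\<Union>n\<le>m. H n)"
    by blast
  \<comment> \<open>At \<open>b\<close> the sum bounds every \<open>g m b\<close> with
    \<open>m\<close> at most \<open>b\<close>; this is why the conclusion is restricted to
    \<open>m\<close> at most \<open>p x\<close>.\<close>
  define h where "h b = (\<Sum>m\<le>b. g m b)" for b
  have h: "g m b \<le> h b" if "m \<le> b" for m b
    unfolding h_def using that by (intro member_le_sum) auto
  obtain F where F: "finite F" "F \<subseteq> (\<Union>n. H n)" "{x. P x \<and> q x < h (p x)} \<subseteq> \<Union>F"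
    using assms[of h] unfolding generated_ideal_def by blast
  from F(2) have "\<forall>A\<in>F. \<exists>n. A \<in> H n" by auto
  from bchoice[OF this] obtain N where N: "\<And>A. A \<in> F \<Longrightarrow> A \<in> H (N A)" by blast
  define m where "m = Max (insert 0 (N ` F))"
  have "F \<subseteq> (\<Union>n\<le>m. H n)"
    using N F(1) by (force simp: m_def)
  then have "{x. P x \<and> q x < h (p x)} \<in> generated_ideal (\<Union>n\<le>m. H n)"
    using F unfolding generated_ideal_def by blast
  then have "{x. P x \<and> m \<le> p x \<and> q x < g m (p x)} \<in> generated_ideal (\<Union>n\<le>m. H n)"
    by (rule generated_ideal_subset) (auto intro: less_le_trans h)
  then show False using g by blast
qed

lemma dominating_bound:
  fixes p q :: "'a \<Rightarrow> nat" and E :: "'i::countable \<Rightarrow> 'a set"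
  shows "\<exists>g. \<forall>i. infinite (p ` E i) \<longrightarrow> infinite {x \<in> E i. q x < g (p x)}"
proof -
  define z where "z i b = (SOME x. x \<in> E i \<and> p x = b)" for i b
  \<comment> \<open>At \<open>b\<close> the bound serves the chosen points of the first
    \<open>b + 1\<close> sets, so the set with code \<open>to_nat i\<close> is missed only at the
    finitely many \<open>b\<close> below its code.\<close>
  define g where "g b = (\<Sum>k\<le>b. Suc (q (z (from_nat k) b)))" for b
  have "infinite {x \<in> E i. q x < g (p x)}" if "infinite (p ` E i)" for i
  proof -
    have "p ` E i - {..<to_nat i} \<subseteq> p ` {x \<in> E i. q x < g (p x)}"
    proof
      fix b assume b: "b \<in> p ` E i - {..<to_nat i}"
      then have "\<exists>x. x \<in> E i \<and> p x = b" by auto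
      then have z: "z i b \<in> E i" "p (z i b) = b"
        unfolding z_def by (metis (mono_tags, lifting) someI_ex)+
      have "Suc (q (z (from_nat (to_nat i)) b)) \<le> g b"
        unfolding g_def using b by (intro member_le_sum) auto
      then have "q (z i b) < g (p (z i b))" using z by simp
      then show "b \<in> p ` {x \<in> E i. q x < g (p x)}" using z by force
    qed
    then show ?thesis
      using that by (metis (no_types, lifting) Diff_infinite_finite finite_imageI finite_lessThan finite_subset)
  qed
  then show ?thesis by blast
qed

section \<open>The impossibility of pulling \<open>Fin_omega\<close> back into
  \<open>Fin'_omega\<close>\<close>

lemma Fin_omega_not_katetov_below_Fin'_omega:
  fixes X :: "nat list \<Rightarrow> nat set"
  assumes indep: "\<And>F s. finite F \<Longrightarrow> (\<And>i. i \<in> F \<Longrightarrow> s i \<in> omega_pow (i + 1)) \<Longrightarrow>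
            infinite (\<Inter>i\<in>F. X (s i))"
    and f: "range f \<subseteq> omega_sum"
  shows "\<exists>A\<in>Fin_omega. f -` A \<notin> Fin'_omega X"
proof (rule ccontr)
  assume "\<not> ?thesis"
  then have ideal: "f -` A \<in> Fin'_omega X" if "A \<in> Fin_omega" for A using that by blast
  define l where "l x = snd (f x)" for x
  define x0 where "x0 x = coord_from_end 0 (l x)" for x
  define x1 where "x1 x = coord_from_end 1 (l x)" for x
  have V: "{x. length (l x) < i \<or> last_coords i (l x) \<in> Q} \<in> Fin'_omega X"
    if "1 \<le> i" "Q \<in> Fin_pow i" for i Q
    unfolding l_def by (rule vimage_last_coords_in_ideal[OF f ideal that])
  have two: "last_coords 2 (l x) = [x1 x, x0 x]" if "2 \<le> length (l x)" for x
    using last_coords_2[OF that] by (simp add: x0_def x1_def)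
  note Fin'_subset = generated_ideal_subset[of _ "\<Union>n. Fin_part n X", folded Fin'_omega_def]
  note Fin'_Un = generated_ideal_Un[of _ "\<Union>n. Fin_part n X", folded Fin'_omega_def]

  have "{x. 2 \<le> length (l x) \<and> x0 x < g (x1 x)} \<in> generated_ideal (\<Union>n. Fin_part n X)" for g
    using V[OF _ Fin_pow_2_graph[of g]] unfolding Fin'_omega_def
    by (rule generated_ideal_subset) (auto simp: two)
  then obtain m where m: "\<And>g. {x. 2 \<le> length (l x) \<and> m \<le> x1 x \<and> x0 x < g (x1 x)}
      \<in> generated_ideal (\<Union>n\<le>m. Fin_part n X)"
    using generated_ideal_uniform_level[of "\<lambda>x. 2 \<le> length (l x)" x0 x1 "\<lambda>n. Fin_part n X"]
    by blast
  define K where "K = generated_ideal (\<Union>n\<in>{m<..}. Fin_part n X)"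
  define Y where "Y = prefix_Inter X m"
  \<comment> \<open>The length \<open>m + 3\<close> is what the rank obstruction demands for
    \<open>Suc m\<close>; the bound on \<open>x1\<close> gives access to the uniform level
    \<open>m\<close>.\<close>
  define E where "E = {x. m + 3 \<le> length (l x) \<and> m \<le> x1 x}"
  have K_subset: "A \<in> K \<Longrightarrow> B \<subseteq> A \<Longrightarrow> B \<in> K" and K_Un: "A \<in> K \<Longrightarrow> B \<in> K \<Longrightarrow> A \<union> B \<in> K" for A B
    unfolding K_def by (auto intro: generated_ideal_subset generated_ideal_Un)
  have fibres: "{\<sigma> \<in> omega_pow (Suc m). A \<inter> Y \<sigma> \<notin> K} \<in> Fin_pow (Suc m)" if "A \<in> Fin'_omega X" for A
    unfolding K_def Y_def by (rule Fin'_omega_positive_fibres) fact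

  let ?N1 = "{\<sigma> \<in> omega_pow (Suc m). - E \<inter> Y \<sigma> \<notin> K}"
  have "- E \<in> Fin'_omega X"
  proof (rule Fin'_subset)
    \<comment> \<open>Taking the empty set at index \<open>m + 3\<close> captures exactly the short
      sequences; the columns below \<open>m\<close> capture the small values of
      \<open>x1\<close>.\<close>
    show "{x. length (l x) < m + 3 \<or> last_coords (m + 3) (l x) \<in> {}}
        \<union> {x. length (l x) < 2 \<or> last_coords 2 (l x) \<in> {[b, a] | a b. b \<in> {..<m}}} \<in> Fin'_omega X"
      by (intro Fin'_Un V Fin_pow_empty Fin_pow_2_columns) auto
    show "- E \<subseteq> {x. length (l x) < m + 3 \<or> last_coords (m + 3) (l x) \<in> {}}
        \<union> {x. length (l x) < 2 \<or> last_coords 2 (l x) \<in> {[b, a] | a b. b \<in> {..<m}}}"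
      by (auto simp: E_def two)
  qed
  then have N1: "?N1 \<in> Fin_pow (Suc m)" by (rule fibres)

  txt \<open>
    If \<open>x1\<close> took infinitely many values on \<open>E \<inter> Y \<sigma>\<close>, then infinitely many points of it would lie
    below a graph. One graph serves all the countably many \<open>\<sigma>\<close>, so level \<open>m\<close> makes such \<open>\<sigma>\<close> rare.
  \<close>
  let ?N2 = "{\<sigma> \<in> omega_pow (Suc m). infinite (x1 ` (E \<inter> Y \<sigma>))}"
  obtain g where g: "\<And>\<sigma>. infinite (x1 ` (E \<inter> Y \<sigma>)) \<Longrightarrow> infinite {x \<in> E \<inter> Y \<sigma>. x0 x < g (x1 x)}"
    using dominating_bound[of x1 "\<lambda>\<sigma>. E \<inter> Y \<sigma>" x0] by blast
  have "infinite ({x. 2 \<le> length (l x) \<and> m \<le> x1 x \<and> x0 x < g (x1 x)} \<inter> Y \<sigma>)"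
    if "infinite (x1 ` (E \<inter> Y \<sigma>))" for \<sigma>
    using g[OF that] by (rule infinite_super[rotated]) (auto simp: E_def)
  then have N2: "?N2 \<in> Fin_pow (Suc m)"
    using low_ideal_infinite_fibres[OF m[of g]] unfolding Y_def[symmetric]
    by (elim Fin_pow_subset) auto

  define S where "S = omega_pow (Suc m) - ?N1 - ?N2"
  have S: "S \<notin> Fin_pow (Suc m)"
  proof
    assume "S \<in> Fin_pow (Suc m)"
    then have "S \<union> (?N1 \<union> ?N2) \<in> Fin_pow (Suc m)" using N1 N2 by (intro Fin_pow_Un)
    then have "omega_pow (Suc m) \<in> Fin_pow (Suc m)"
      by (rule Fin_pow_subset) (auto simp: S_def)
    then show False using omega_pow_notin_Fin_pow by blast
  qed
  have "\<exists>b. E \<inter> Y \<sigma> \<inter> {x. x1 x = b} \<notin> K" if "\<sigma> \<in> S" for \<sigma>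
  proof (rule ccontr)
    assume "\<not> ?thesis"
    \<comment> \<open>Outside \<open>?N2\<close> this union is finite, so if every piece were in
      \<open>K\<close> then so would be the fibre inside \<open>E\<close>, and outside
      \<open>?N1\<close> the whole fibre.\<close>
    then have "(\<Union>b\<in>x1 ` (E \<inter> Y \<sigma>). E \<inter> Y \<sigma> \<inter> {x. x1 x = b}) \<in> K"
      using that unfolding K_def S_def by (intro generated_ideal_UN) auto
    then have "E \<inter> Y \<sigma> \<in> K" by (rule K_subset) auto
    moreover have "- E \<inter> Y \<sigma> \<in> K" using that by (auto simp: S_def)
    ultimately have "E \<inter> Y \<sigma> \<union> - E \<inter> Y \<sigma> \<in> K" by (rule K_Un)
    then have "Y \<sigma> \<in> K" by (rule K_subset) auto
    moreover have "Y \<sigma> \<notin> K"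
      unfolding Y_def K_def
    proof (rule prefix_Inter_notin_high_ideal)
      show "\<sigma> \<in> omega_pow (Suc m)" using that by (simp add: S_def)
    qed (rule indep)
    ultimately show False by blast
  qed
  then obtain b where b: "\<And>\<sigma>. \<sigma> \<in> S \<Longrightarrow> E \<inter> Y \<sigma> \<inter> {x. x1 x = b \<sigma>} \<notin> K" by metis
  define W where "W \<sigma> = E \<inter> Y \<sigma> \<inter> {x. x1 x = b \<sigma>}" for \<sigma>
  have "\<exists>Q\<in>Fin_pow (Suc m + 2).
      {\<sigma> \<in> S. W \<sigma> \<inter> {x. last_coords (Suc m + 2) (l x) \<in> Q} \<notin> K} \<notin> Fin_pow (Suc m)"
    unfolding K_def
  proof (rule Fin_pow_rank_obstruction)
    show "S \<subseteq> omega_pow (Suc m)" by (auto simp: S_def)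
    show "W \<sigma> \<notin> generated_ideal (\<Union>n\<in>{m<..}. Fin_part n X)" if "\<sigma> \<in> S" for \<sigma>
      using b[OF that] by (simp add: W_def K_def)
    show "Suc m + 2 \<le> length (l x) \<and> coord_from_end 1 (l x) = b \<sigma>" if "x \<in> W \<sigma>" for \<sigma> x
      using that by (auto simp: W_def E_def x1_def)
  qed fact
  then obtain Q where Q: "Q \<in> Fin_pow (Suc m + 2)"
    and pos: "{\<sigma> \<in> S. W \<sigma> \<inter> {x. last_coords (Suc m + 2) (l x) \<in> Q} \<notin> K} \<notin> Fin_pow (Suc m)"
    by blast
  \<comment> \<open>As a pullback, \<open>?V\<close> can be \<open>K\<close>-positive only on a
    small set of fibres, whereas \<open>pos\<close> makes it positive on a non-small one.\<close>
  let ?V = "{x. length (l x) < Suc m + 2 \<or> last_coords (Suc m + 2) (l x) \<in> Q}"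
  have "{\<sigma> \<in> omega_pow (Suc m). ?V \<inter> Y \<sigma> \<notin> K} \<in> Fin_pow (Suc m)"
    by (intro fibres V Q) simp
  moreover have "{\<sigma> \<in> S. W \<sigma> \<inter> {x. last_coords (Suc m + 2) (l x) \<in> Q} \<notin> K}
      \<subseteq> {\<sigma> \<in> omega_pow (Suc m). ?V \<inter> Y \<sigma> \<notin> K}"
  proof -
    have "W \<sigma> \<inter> {x. last_coords (Suc m + 2) (l x) \<in> Q} \<subseteq> ?V \<inter> Y \<sigma>" for \<sigma>
      by (auto simp: W_def)
    then show ?thesis using K_subset unfolding S_def by blast
  qed
  ultimately show False using pos Fin_pow_subset by blast
qed

theorem theorem4p6:
  fixes X :: "nat list \<Rightarrow> nat set"
  assumes "\<And>n. disjoint_family_on X (omega_pow (n + 1))"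
    and "\<And>n. (\<Union>s\<in>omega_pow (n + 1). X s) = UNIV"
    and "\<And>n s. s \<in> omega_pow (n + 1) \<Longrightarrow> infinite (X s)"
    and "\<And>F s. finite F \<Longrightarrow> (\<And>i. i \<in> F \<Longrightarrow> s i \<in> omega_pow (i + 1)) \<Longrightarrow>
            infinite (\<Inter>i\<in>F. X (s i))"
  shows "\<not> ideal_sqsub omega_sum Fin_omega UNIV (Fin'_omega X)"
proof
  assume "ideal_sqsub omega_sum Fin_omega UNIV (Fin'_omega X)"
  then obtain f where f: "bij_betw f UNIV omega_sum" "\<forall>A\<in>Fin_omega. f -` A \<inter> UNIV \<in> Fin'_omega X"
    unfolding ideal_sqsub_def by blast
  have "\<exists>A\<in>Fin_omega. f -` A \<notin> Fin'_omega X"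
  proof (rule Fin_omega_not_katetov_below_Fin'_omega)
    show "range f \<subseteq> omega_sum" using f(1) by (simp add: bij_betw_def)
  qed (rule assms(4))
  then show False using f(2) by simp
qed

end
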